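(* Let $K=\mathbb{Q}(q)$ be the field of rational functions in $q$ over $\mathbb{Q}$ and let $EXP\in K\{\{x\}\}_\infty$ be the generic planar tree exponential series. Then $$\hat\Delta(EXP)=EXP\,\hat\otimes\,EXP.$$
   Context: Trees and algebra. A finite planar rooted tree is a (nonempty) finite rooted tree with a linear (left-to-right) order on the set of children of each vertex. The arity of a vertex is the number of its children, and $ar(T)$ is the arity of the root of $T$; $T$ is reduced if no vertex has arity $1$. $\mathbf{PRT}$ is the set of isomorphism classes of finite planar reduced rooted trees, $\mathbf{PRT}'=\{1\}\,\dot\cup\,\mathbf{PRT}$ with $1$ the empty tree, and $x\in\mathbf{PRT}$ is the tree with a single vertex. $\deg(T)$ is the number of leaves (vertices of arity $0$) of $T$, $\deg(1)=0$. $\mathbf{A}=K\{x\}_\infty$ is the $K$-vector space with basis $\mathbf{PRT}'$, equipped for each $m\ge2$ with the $m$-ary product $\cdot_m:\mathbf{A}^m\to\mathbf{A}$, $\cdot_m(f_1,\dots,f_m)=f_1\cdots f_m$, the $K$-multilinear extension of $m$-ary grafting on $\mathbf{PRT}'$: for $T_1,\dots,T_m\in\mathbf{PRT}$ the grafting adds a new root whose children are, in order, the roots of $T_1,\dots,T_m$; entries equal to $1$ are deleted, i.e. if exactly $r$ of the entries are $\neq1$, the product is the $r$-ary grafting of these (in order) when $r\ge2$, the single remaining tree when $r=1$, and $1$ when $r=0$. Co-addition. $\mathbf{B}=\mathbf{A}\otimes_K\mathbf{A}$ carries for each $m\ge2$ the $K$-multilinear operation with $\cdot_m(f_1\otimes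 g_1,\dots,f_m\otimes g_m)=(f_1\cdots f_m)\otimes(g_1\cdots g_m)$. $\Delta:\mathbf{A}\to\mathbf{B}$ is the unique $K$-linear map with $\Delta(1)=1\otimes1$, compatible with all $\cdot_m$ ($m\ge2$), and with $\Delta(x)=x\otimes1+1\otimes x$. Completions. $\hat{\mathbf{A}}=K\{\{x\}\}_\infty$ is the $x$-adic completion of $\mathbf{A}$, i.e. the space of formal series $\sum_{T\in\mathbf{PRT}'}a_T\,T$ with $a_T\in K$; $\hat{\mathbf{B}}=\hat{\mathbf{A}}\hat\otimes\hat{\mathbf{A}}$ is the $(x\otimes1,1\otimes x)$-adic completion of $\mathbf{B}$, i.e. the space of formal series $\sum_{V,W\in\mathbf{PRT}'}b_{V,W}\,V\otimes W$ with $b_{V,W}\in K$. $\hat\Delta:\hat{\mathbf{A}}\to\hat{\mathbf{B}}$ is the continuous extension of $\Delta$ (note that $\Delta$ preserves degree, where $\deg(V\otimes W)=\deg V+\deg W$), so $\hat\Delta(\sum a_T T)=\sum a_T\Delta(T)$. For $f=\sum a_T T$ and $g=\sum b_T T$, $f\hat\otimes g=\sum_{V,W}a_V b_W\,V\otimes W$. Generic exponential. $EXP=\sum_{T\in\mathbf{PRT}'}a(T)\,T$, where $a(T)\in\mathbb{Q}(q)$ is given by $a(1)=a(x)=1$ and recursively $$a(T)=\frac{\binom{q}{m}}{q^n-q}\,a(T_1)\cdots a(T_m)$$ if $m=ar(T)\ge2$, $T=T_1\cdot T_2\cdots T_m$ ($m$-ary grafting, $T_i\in\mathbf{PRT}$)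 and $n=\deg(T)$; here $\binom{q}{m}=\frac{q(q-1)\cdots(q-m+1)}{m!}$. *)

theory Defs
  imports
    "HOL-Library.Poly_Mapping"
    "HOL-Library.Groups_Big_Fun"
    "HOL-Computational_Algebra.Computational_Algebra"
begin

section \<open>Planar reduced rooted trees\<close>

text \<open>
  A planar rooted tree up to isomorphism is its root together with the list of the subtrees
  at the children of the root.
\<close>

datatype ptree = Node "ptree list"

fun reduced :: "ptree \<Rightarrow> bool" where
  "reduced (Node ts) \<longleftrightarrow> length ts \<noteq> 1 \<and> (\<forall>t\<in>set ts. reduced t)"

fun leaves :: "ptree \<Rightarrow> nat" where
  "leaves (Node ts) = (if ts = [] then 1 else sum_list (map leaves ts))"

typedef prt = "{t. reduced t}"
  by (rule exI[of _ "Node []"]) simp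

text \<open>The empty tree \<open>1\<close> is \<^term>\<open>None\<close>.\<close>

type_synonym prt1 = "prt option"

definition tree_x :: prt where
  "tree_x = Abs_prt (Node [])"

fun deg :: "prt1 \<Rightarrow> nat" where
  "deg None = 0"
| "deg (Some t) = leaves (Rep_prt t)"

text \<open>
  Grafting of a list of possibly empty trees; the arity is the length of the list and the
  empty trees are deleted first.
\<close>

definition graft :: "prt1 list \<Rightarrow> prt1" where
  "graft ts =
    (case List.map_filter id ts of
       [] \<Rightarrow> None
     | [t] \<Rightarrow> Some t
     | us \<Rightarrow> Some (Abs_prt (Node (map Rep_prt us))))"


section \<open>Free vector spaces and multilinear extension\<close>

text \<open>
  The vector space over \<open>'k\<close> with basis \<open>'b\<close> is the type \<open>'b \<Rightarrow>\<^sub>0 'k\<close> of finitely supported functions.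
\<close>

definition scale :: "'k::field \<Rightarrow> ('b \<Rightarrow>\<^sub>0 'k) \<Rightarrow> ('b \<Rightarrow>\<^sub>0 'k)" where
  "scale c = Poly_Mapping.map ((*) c)"

definition basis :: "'b \<Rightarrow> ('b \<Rightarrow>\<^sub>0 'k::field)" where
  "basis b = Poly_Mapping.single b 1"

definition multilinear_ext ::
    "('b list \<Rightarrow> ('c \<Rightarrow>\<^sub>0 'k::field)) \<Rightarrow> ('b \<Rightarrow>\<^sub>0 'k) list \<Rightarrow> ('c \<Rightarrow>\<^sub>0 'k)" where
  "multilinear_ext h fs =
    (\<Sum>bs\<in>listset (map Poly_Mapping.keys fs).
       scale (prod_list (map2 Poly_Mapping.lookup fs bs)) (h bs))"


section \<open>The algebra, its tensor square and the co-addition\<close>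

type_synonym 'k alg = "prt1 \<Rightarrow>\<^sub>0 'k"

text \<open>The pair \<open>(V, W)\<close> stands for the basis element \<open>V \<otimes> W\<close> of the tensor square.\<close>

type_synonym 'k alg2 = "(prt1 \<times> prt1) \<Rightarrow>\<^sub>0 'k"

text \<open>The \<open>m\<close>-ary products are applied to lists of length \<open>m\<close>.\<close>

definition mprod :: "'k::field alg list \<Rightarrow> 'k alg" where
  "mprod = multilinear_ext (\<lambda>ts. basis (graft ts))"

definition mprod2 :: "'k::field alg2 list \<Rightarrow> 'k alg2" where
  "mprod2 = multilinear_ext (\<lambda>ps. basis (graft (map fst ps), graft (map snd ps)))"

definition tensor :: "'k::field alg \<Rightarrow> 'k alg \<Rightarrow> 'k alg2" where
  "tensor f g = (\<Sum>V\<in>Poly_Mapping.keys f. \<Sum>W\<in>Poly_Mapping.keys g.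
     Poly_Mapping.single (V, W) (Poly_Mapping.lookup f V * Poly_Mapping.lookup g W))"

definition is_coaddition :: "('k::field alg \<Rightarrow> 'k alg2) \<Rightarrow> bool" where
  "is_coaddition D \<longleftrightarrow>
     Vector_Spaces.linear scale scale D \<and>
     D (basis None) = tensor (basis None) (basis None) \<and>
     (\<forall>fs. length fs \<ge> 2 \<longrightarrow> D (mprod fs) = mprod2 (map D fs)) \<and>
     D (basis (Some tree_x)) =
       tensor (basis (Some tree_x)) (basis None) + tensor (basis None) (basis (Some tree_x))"

text \<open>Existence and uniqueness are proved in \<open>ex1_is_coaddition\<close> below.\<close>

definition coaddition :: "'k::field alg \<Rightarrow> 'k alg2" where
  "coaddition = (THE D. is_coaddition D)"


section \<open>Completions\<close>

type_synonym 'k alg_hat = "prt1 \<Rightarrow> 'k"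

type_synonym 'k alg2_hat = "prt1 \<times> prt1 \<Rightarrow> 'k"

text \<open>
  The coefficient of \<open>V \<otimes> W\<close> in \<open>\<Sum>T. a T \<cdot> \<Delta>(T)\<close> is the sum below; only finitely many summands
  are nonzero, see \<open>finite_coaddition_hat_support\<close>.
\<close>

definition coaddition_hat :: "'k::field alg_hat \<Rightarrow> 'k alg2_hat" where
  "coaddition_hat f = (\<lambda>p. Sum_any (\<lambda>T. f T * Poly_Mapping.lookup (coaddition (basis T)) p))"

definition tensor_hat :: "'k::field alg_hat \<Rightarrow> 'k alg_hat \<Rightarrow> 'k alg2_hat" where
  "tensor_hat f g = (\<lambda>(V, W). f V * g W)"


section \<open>The generic exponential\<close>

type_synonym ratfun = "rat poly fract"

definition qvar :: ratfun where
  "qvar = Fract [:0, 1:] 1"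

text \<open>Only the values on reduced trees are used, so lists of length one do not matter.\<close>

fun exp_coeff_tree :: "ptree \<Rightarrow> ratfun" where
  "exp_coeff_tree (Node ts) =
     (if ts = [] then 1
      else (qvar gchoose length ts) / (qvar ^ leaves (Node ts) - qvar) * prod_list (map exp_coeff_tree ts))"

fun EXP :: "ratfun alg_hat" where
  "EXP None = 1"
| "EXP (Some t) = exp_coeff_tree (Rep_prt t)"


section \<open>Well-definedness\<close>

lemma lookup_scale [simp]: "Poly_Mapping.lookup (scale c f) b = c * Poly_Mapping.lookup f b"
  unfolding scale_def by (simp add: Poly_Mapping.map.rep_eq when_def)

interpretation fv: vector_space scale
  by unfold_locales (auto intro!: poly_mapping_eqI simp: lookup_add algebra_simps)

lemma lookup_tensor:
  "Poly_Mapping.lookup (tensor f g) (V, W) = Poly_Mapping.lookup f V * Poly_Mapping.lookup g W"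
proof -
  have "Poly_Mapping.lookup (tensor f g) (V, W) =
      (\<Sum>V'\<in>Poly_Mapping.keys f. \<Sum>W'\<in>Poly_Mapping.keys g.
        if W' = W then (if V' = V then Poly_Mapping.lookup f V * Poly_Mapping.lookup g W else 0) else 0)"
    unfolding tensor_def lookup_sum
    by (intro sum.cong refl) (auto simp: lookup_single when_def)
  also have "\<dots> = Poly_Mapping.lookup f V * Poly_Mapping.lookup g W"
    by (cases "Poly_Mapping.lookup g W = 0"; cases "Poly_Mapping.lookup f V = 0")
      (simp_all add: sum.delta in_keys_iff)
  finally show ?thesis .
qed

lemma tensor_basis: "tensor (basis V) (basis W) = basis (V, W)"
  by (rule poly_mapping_eqI) (auto simp: lookup_tensor basis_def lookup_single when_def split: prod.splits if_splits)

lemma tensor_add_left: "tensor (f + f') g = tensor f g + tensor f' g"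
  by (rule poly_mapping_eqI) (auto simp: lookup_tensor lookup_add algebra_simps)

lemma tensor_add_right: "tensor f (g + g') = tensor f g + tensor f g'"
  by (rule poly_mapping_eqI) (auto simp: lookup_tensor lookup_add algebra_simps)

lemma tensor_scale_left: "tensor (scale c f) g = scale c (tensor f g)"
  by (rule poly_mapping_eqI) (auto simp: lookup_tensor algebra_simps)

lemma tensor_scale_right: "tensor f (scale c g) = scale c (tensor f g)"
  by (rule poly_mapping_eqI) (auto simp: lookup_tensor algebra_simps)

text \<open>Linear extension of a map on the basis.\<close>

definition lin_ext :: "('b \<Rightarrow> ('c \<Rightarrow>\<^sub>0 'k::field)) \<Rightarrow> ('b \<Rightarrow>\<^sub>0 'k) \<Rightarrow> ('c \<Rightarrow>\<^sub>0 'k)" where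
  "lin_ext \<phi> f = (\<Sum>b\<in>Poly_Mapping.keys f. scale (Poly_Mapping.lookup f b) (\<phi> b))"

lemma lin_ext_superset:
  assumes "finite S" "Poly_Mapping.keys f \<subseteq> S"
  shows "lin_ext \<phi> f = (\<Sum>b\<in>S. scale (Poly_Mapping.lookup f b) (\<phi> b))"
  unfolding lin_ext_def
  by (rule sum.mono_neutral_left[OF assms]) (auto simp: in_keys_iff)

lemma linear_lin_ext:
  fixes \<phi> :: "'b \<Rightarrow> ('c \<Rightarrow>\<^sub>0 'k::field)"
  shows "Vector_Spaces.linear scale scale (lin_ext \<phi>)"
proof unfold_locales
  fix f g :: "'b \<Rightarrow>\<^sub>0 'k"
  let ?S = "Poly_Mapping.keys f \<union> Poly_Mapping.keys g"
  have "lin_ext \<phi> (f + g) = (\<Sum>b\<in>?S. scale (Poly_Mapping.lookup (f + g) b) (\<phi> b))"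
    by (rule lin_ext_superset) (auto simp: Poly_Mapping.keys_add)
  also have "\<dots> = (\<Sum>b\<in>?S. scale (Poly_Mapping.lookup f b) (\<phi> b))
      + (\<Sum>b\<in>?S. scale (Poly_Mapping.lookup g b) (\<phi> b))"
    by (simp add: lookup_add fv.scale_left_distrib sum.distrib)
  also have "\<dots> = lin_ext \<phi> f + lin_ext \<phi> g"
    by (simp add: lin_ext_superset[where S = ?S])
  finally show "lin_ext \<phi> (f + g) = lin_ext \<phi> f + lin_ext \<phi> g" .
next
  fix c :: 'k and f :: "'b \<Rightarrow>\<^sub>0 'k"
  have "lin_ext \<phi> (scale c f) =
      (\<Sum>b\<in>Poly_Mapping.keys f. scale (Poly_Mapping.lookup (scale c f) b) (\<phi> b))"
    by (rule lin_ext_superset) (auto simp: in_keys_iff)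
  also have "\<dots> = scale c (lin_ext \<phi> f)"
    by (simp add: lin_ext_def fv.scale_sum_right)
  finally show "lin_ext \<phi> (scale c f) = scale c (lin_ext \<phi> f)" .
qed

interpretation lx: Vector_Spaces.linear scale scale "lin_ext \<phi>" for \<phi>
  by (rule linear_lin_ext)

lemma lin_ext_basis [simp]: "lin_ext \<phi> (basis b) = \<phi> b"
  by (simp add: lin_ext_def basis_def lookup_single)

lemma lin_ext_expand: "lin_ext basis f = f"
proof (rule poly_mapping_eqI)
  fix b
  show "Poly_Mapping.lookup (lin_ext basis f) b = Poly_Mapping.lookup f b"
    by (simp add: lin_ext_def basis_def lookup_sum lookup_single when_def if_distrib[where f = "\<lambda>x. _ * x"]
        in_keys_iff cong: if_cong)
qed

lemma linear_eq_lin_ext: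
  assumes "Vector_Spaces.linear scale scale D"
  shows "D f = lin_ext (\<lambda>b. D (basis b)) f"
proof -
  interpret D: Vector_Spaces.linear scale scale D by fact
  have "D f = D (lin_ext basis f)" by (simp add: lin_ext_expand)
  also have "\<dots> = lin_ext (\<lambda>b. D (basis b)) f"
    by (simp add: lin_ext_def D.sum D.scale)
  finally show ?thesis .
qed

lemma lin_ext_lin_ext: "lin_ext \<phi> (lin_ext \<psi> f) = lin_ext (\<lambda>b. lin_ext \<phi> (\<psi> b)) f"
  unfolding lin_ext_def[of \<psi>] lin_ext_def[of "\<lambda>b. lin_ext \<phi> (\<psi> b)"]
  by (simp add: lx.sum lx.scale)

lemma lin_ext_swap: "lin_ext (\<lambda>u. lin_ext (\<lambda>v. \<phi> u v) g) f = lin_ext (\<lambda>v. lin_ext (\<lambda>u. \<phi> u v) f) g"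
  unfolding lin_ext_def fv.scale_sum_right
  by (subst sum.swap) (simp add: mult.commute)

lemma multilinear_ext_Nil [simp]: "multilinear_ext h [] = h []"
  by (simp add: multilinear_ext_def)

lemma multilinear_ext_Cons:
  "multilinear_ext h (f # fs) = lin_ext (\<lambda>b. multilinear_ext (\<lambda>bs. h (b # bs)) fs) f"
proof -
  let ?A = "Poly_Mapping.keys f" and ?X = "listset (map Poly_Mapping.keys fs)"
  have eq: "set_Cons ?A ?X = (\<lambda>(x, xs). x # xs) ` (?A \<times> ?X)"
    by (auto simp: set_Cons_def)
  show ?thesis
    unfolding multilinear_ext_def lin_ext_def fv.scale_sum_right
    by (simp add: eq sum.reindex inj_on_def sum.cartesian_product case_prod_unfold)
qed

lemma multilinear_ext_map_basis [simp]: "multilinear_ext h (map basis bs) = h bs"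
  by (induction bs arbitrary: h) (simp_all add: multilinear_ext_Cons)

lemma lin_ext_multilinear_ext:
  "lin_ext \<phi> (multilinear_ext h fs) = multilinear_ext (\<lambda>bs. lin_ext \<phi> (h bs)) fs"
  by (induction fs arbitrary: h) (simp_all add: multilinear_ext_Cons lin_ext_lin_ext)

lemma multilinear_ext_lin_ext:
  "multilinear_ext (\<lambda>bs. lin_ext (\<lambda>u. h u bs) f) fs = lin_ext (\<lambda>u. multilinear_ext (h u) fs) f"
proof (induction fs arbitrary: h)
  case (Cons g gs)
  show ?case
    by (simp add: multilinear_ext_Cons Cons.IH[of "\<lambda>u bs. h u (_ # bs)"] lin_ext_swap[of _ f])
qed simp

lemma multilinear_ext_map_lin_ext:
  "multilinear_ext h (map (lin_ext \<phi>) fs) = multilinear_ext (\<lambda>bs. multilinear_ext h (map \<phi> bs)) fs"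
proof (induction fs arbitrary: h)
  case (Cons f fs)
  show ?case
    by (simp add: multilinear_ext_Cons Cons.IH lin_ext_lin_ext multilinear_ext_lin_ext)
qed simp

lemma keys_multilinear_ext:
  assumes "p \<in> Poly_Mapping.keys (multilinear_ext h fs)"
  obtains bs where "bs \<in> listset (map Poly_Mapping.keys fs)" "p \<in> Poly_Mapping.keys (h bs)"
proof -
  have "\<exists>bs\<in>listset (map Poly_Mapping.keys fs). Poly_Mapping.lookup (h bs) p \<noteq> 0"
  proof (rule ccontr)
    assume "\<not> ?thesis"
    then have "Poly_Mapping.lookup (multilinear_ext h fs) p = 0"
      by (simp add: multilinear_ext_def lookup_sum)
    with assms show False by (simp add: in_keys_iff)
  qed
  then show ?thesis using that by (auto simp: in_keys_iff)
qed

text \<open>The products on the tensor square satisfy their defining identity on all pure tensors.\<close>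

lemma lin_ext_tensor:
  "lin_ext \<phi> (tensor f g) = lin_ext (\<lambda>V. lin_ext (\<lambda>W. \<phi> (V, W)) g) f"
proof -
  have "tensor f g = lin_ext (\<lambda>V. lin_ext (\<lambda>W. basis (V, W)) g) f"
    unfolding tensor_def lin_ext_def fv.scale_sum_right
    by (intro sum.cong refl poly_mapping_eqI) (auto simp: basis_def lookup_single when_def)
  then show ?thesis by (simp add: lin_ext_lin_ext)
qed

lemma tensor_lin_ext:
  fixes \<phi> :: "'b \<Rightarrow> 'k::field alg" and \<psi> :: "'c \<Rightarrow> 'k alg"
  shows "tensor (lin_ext \<phi> f) (lin_ext \<psi> g) = lin_ext (\<lambda>V. lin_ext (\<lambda>W. tensor (\<phi> V) (\<psi> W)) g) f"
proof -
  have lin1: "Vector_Spaces.linear scale scale (\<lambda>u. tensor u v)" for v :: "'k alg"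
    by unfold_locales (simp_all add: tensor_add_left tensor_scale_left)
  have lin2: "Vector_Spaces.linear scale scale (\<lambda>v. tensor u v)" for u :: "'k alg"
    by unfold_locales (simp_all add: tensor_add_right tensor_scale_right)
  show ?thesis
    by (subst linear_eq_lin_ext[OF lin1], subst lin_ext_lin_ext, subst linear_eq_lin_ext[OF lin1, symmetric],
        subst linear_eq_lin_ext[OF lin2], subst lin_ext_lin_ext, subst linear_eq_lin_ext[OF lin2, symmetric]) simp
qed

lemma multilinear_ext_tensor:
  "length fs = length gs \<Longrightarrow>
   multilinear_ext (\<lambda>ps. tensor (h (map fst ps)) (k (map snd ps))) (map2 tensor fs gs) =
   tensor (multilinear_ext h fs) (multilinear_ext k gs)"
proof (induction fs gs arbitrary: h k rule: list_induct2)
  case (Cons f fs g gs)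
  show ?case
    by (simp add: multilinear_ext_Cons lin_ext_tensor tensor_lin_ext
        Cons.IH[of "\<lambda>bs. h (_ # bs)" "\<lambda>bs. k (_ # bs)"])
qed simp

lemma mprod2_tensor:
  "length fs = length gs \<Longrightarrow> mprod2 (map2 tensor fs gs) = tensor (mprod fs) (mprod gs)"
  using multilinear_ext_tensor[of fs gs "\<lambda>ts. basis (graft ts)" "\<lambda>ts. basis (graft ts)"]
  by (simp add: mprod_def mprod2_def tensor_basis)

lemma reduced_Rep_prt [simp]: "reduced (Rep_prt t)"
  using Rep_prt by auto

lemma Rep_prt_tree_x [simp]: "Rep_prt tree_x = Node []"
  by (simp add: tree_x_def Abs_prt_inverse)

lemma Rep_Abs_prt_Node:
  "length us \<noteq> 1 \<Longrightarrow> Rep_prt (Abs_prt (Node (map Rep_prt us))) = Node (map Rep_prt us)"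
  by (rule Abs_prt_inverse) auto

lemma prt_Node_obtain:
  assumes "Rep_prt t = Node ts"
  obtains us where "ts = map Rep_prt us" "length us \<noteq> 1"
proof
  have r: "reduced (Node ts)" using assms reduced_Rep_prt[of t] by simp
  then show "ts = map Rep_prt (map Abs_prt ts)"
    by (auto simp: Abs_prt_inverse intro!: map_idI[symmetric])
  show "length (map Abs_prt ts) \<noteq> 1" using r by simp
qed

lemma map_filter_id_map_Some [simp]: "List.map_filter id (map Some us) = us"
  by (induction us) auto

lemma graft_Some:
  assumes "Rep_prt t = Node (map Rep_prt us)" "length us \<ge> 2"
  shows "graft (map Some us) = Some t"
proof -
  have "Abs_prt (Node (map Rep_prt us)) = t"
    by (metis assms(1) Rep_prt_inverse)
  then show ?thesis
    using assms(2) by (auto simp: graft_def split: list.splits)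
qed

lemma graft_Cons_None: "graft (us @ None # vs) = graft (us @ vs)"
  by (simp add: graft_def List.map_filter_def)

lemma graft_filter: "graft ts = graft (map Some (List.map_filter id ts))"
  by (simp add: graft_def)

lemma graft_single [simp]: "graft [t] = t"
  by (cases t) (simp_all add: graft_def)

lemma graft_Nil [simp]: "graft [] = None"
  by (simp add: graft_def)

lemma coaddition_unique_basis:
  assumes D: "is_coaddition D" and D': "is_coaddition D'"
  shows "D (basis (Some t)) = D' (basis (Some t))"
proof (induction "Rep_prt t" arbitrary: t)
  case (Node ts t)
  obtain us where us: "ts = map Rep_prt us" "length us \<noteq> 1"
    using prt_Node_obtain[OF Node.hyps(2)[symmetric]] by blast
  show ?case
  proof (cases "us = []")
    case True
    then have "t = tree_x"
      using Node.hyps(2) us by (metis Rep_prt_inverse list.simps(8) tree_x_def)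
    then show ?thesis using D D' by (simp add: is_coaddition_def)
  next
    case False
    then have len: "length us \<ge> 2" using us by (cases us; cases "tl us") auto
    let ?fs = "map basis (map Some us)"
    have m: "basis (Some t) = mprod ?fs"
      unfolding mprod_def multilinear_ext_map_basis
      using graft_Some[OF _ len] Node.hyps(2) us by simp
    have "map D ?fs = map D' ?fs"
      using Node.hyps(1) us by auto
    moreover have "D (mprod ?fs) = mprod2 (map D ?fs)" "D' (mprod ?fs) = mprod2 (map D' ?fs)"
      using D D' len unfolding is_coaddition_def by (metis length_map)+
    ultimately show ?thesis by (simp only: m)
  qed
qed

lemma coaddition_unique:
  assumes D: "is_coaddition D" and D': "is_coaddition D'"
  shows "D = D'"
proof
  fix f
  have "D (basis b) = D' (basis b)" for b
    using coaddition_unique_basis[OF assms] assms by (cases b) (simp_all add: is_coaddition_def)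
  moreover have "Vector_Spaces.linear scale scale D" "Vector_Spaces.linear scale scale D'"
    using assms by (simp_all add: is_coaddition_def)
  ultimately show "D f = D' f" by (metis linear_eq_lin_ext ext)
qed

fun coadd_tree :: "ptree \<Rightarrow> 'k::field alg2" where
  "coadd_tree (Node ts) =
     (if ts = [] then basis (Some tree_x, None) + basis (None, Some tree_x)
      else mprod2 (map coadd_tree ts))"

fun coadd_basis :: "prt1 \<Rightarrow> 'k::field alg2" where
  "coadd_basis None = basis (None, None)"
| "coadd_basis (Some t) = coadd_tree (Rep_prt t)"

lemma multilinear_ext_coadd_filter:
  assumes "\<And>us vs. h (us @ (None, None) # vs) = h (us @ vs)"
  shows "multilinear_ext h (map coadd_basis ts) =
    multilinear_ext h (map coadd_basis (map Some (List.map_filter id ts)))"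
  using assms
proof (induction ts arbitrary: h)
  case (Cons t ts)
  show ?case
  proof (cases t)
    case None
    have "(\<lambda>bs. h ((None, None) # bs)) = h"
      using Cons.prems[of "[]"] by auto
    then show ?thesis
      using None Cons.IH[of h, OF Cons.prems] by (simp add: multilinear_ext_Cons)
  next
    case (Some u)
    have "multilinear_ext (\<lambda>bs. h (b # bs)) (map coadd_basis ts) =
      multilinear_ext (\<lambda>bs. h (b # bs)) (map coadd_basis (map Some (List.map_filter id ts)))" for b
      by (rule Cons.IH) (use Cons.prems[of "b # _"] in simp)
    then show ?thesis using Some by (simp add: multilinear_ext_Cons id_def)
  qed
qed simp

lemma coadd_basis_graft: "coadd_basis (graft ts) = mprod2 (map coadd_basis ts)"
proof -
  define us where "us = List.map_filter id ts"
  have "mprod2 (map coadd_basis ts) = mprod2 (map coadd_basis (map Some us))"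
    unfolding mprod2_def us_def
    by (rule multilinear_ext_coadd_filter) (simp add: graft_Cons_None)
  also have "\<dots> = coadd_basis (graft (map Some us))"
  proof -
    consider "us = []" | u where "us = [u]" | "length us \<ge> 2"
      by (cases us; cases "tl us") auto
    then show ?thesis
    proof cases
      case 1
      then show ?thesis by (simp add: mprod2_def)
    next
      case 2
      then show ?thesis by (simp add: mprod2_def multilinear_ext_Cons lin_ext_expand)
    next
      case 3
      define t where "t = Abs_prt (Node (map Rep_prt us))"
      have t: "Rep_prt t = Node (map Rep_prt us)"
        using 3 by (simp add: t_def Rep_Abs_prt_Node)
      have "us \<noteq> []" using 3 by auto
      then show ?thesis using graft_Some[OF t 3] t by (simp add: comp_def)
    qed
  qed
  finally show ?thesis using graft_filter[of ts] unfolding us_def by metis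
qed

lemma is_coaddition_lin_ext: "is_coaddition (lin_ext coadd_basis)"
  unfolding is_coaddition_def
proof (intro conjI allI impI)
  show "Vector_Spaces.linear scale scale (lin_ext coadd_basis)" by (rule linear_lin_ext)
  fix fs :: "'a alg list"
  show "lin_ext coadd_basis (mprod fs) = mprod2 (map (lin_ext coadd_basis) fs)"
    unfolding mprod_def lin_ext_multilinear_ext
    by (simp add: coadd_basis_graft mprod2_def multilinear_ext_map_lin_ext)
qed (simp_all add: tensor_basis)

lemma ex1_is_coaddition: "\<exists>!D. is_coaddition (D :: 'k::field alg \<Rightarrow> 'k alg2)"
  using is_coaddition_lin_ext coaddition_unique by blast

lemma is_coaddition_coaddition: "is_coaddition coaddition"
  unfolding coaddition_def by (rule theI'[OF ex1_is_coaddition])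

lemma coaddition_basis: "coaddition (basis T) = coadd_basis T"
  by (simp add: coaddition_unique[OF is_coaddition_coaddition is_coaddition_lin_ext])

lemma deg_graft: "deg (graft ts) = sum_list (map deg ts)"
proof -
  define us where "us = List.map_filter id ts"
  have 1: "sum_list (map deg ts) = sum_list (map (\<lambda>u. leaves (Rep_prt u)) us)"
    unfolding us_def by (induction ts) (auto split: option.splits)
  consider "us = []" | u where "us = [u]" | "length us \<ge> 2"
    by (cases us; cases "tl us") auto
  then have "deg (graft (map Some us)) = sum_list (map (\<lambda>u. leaves (Rep_prt u)) us)"
  proof cases
    case 3
    define t where "t = Abs_prt (Node (map Rep_prt us))"
    have t: "Rep_prt t = Node (map Rep_prt us)"
      using 3 by (simp add: t_def Rep_Abs_prt_Node)
    show ?thesis using graft_Some[OF t 3] t 3 by (auto simp: comp_def)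
  qed auto
  then show ?thesis using 1 graft_filter[of ts] by (simp add: us_def)
qed

lemma sum_list_listset:
  assumes "ps \<in> listset (map g ts)" "\<And>t p. t \<in> set ts \<Longrightarrow> p \<in> g t \<Longrightarrow> a p = (b t :: nat)"
  shows "sum_list (map a ps) = sum_list (map b ts)"
  using assms
proof (induction ts arbitrary: ps)
  case (Cons t ts)
  then show ?case by (auto simp: set_Cons_def)
qed simp

lemma keys_coadd_tree:
  "p \<in> Poly_Mapping.keys (coadd_tree t :: 'k::field alg2) \<Longrightarrow> deg (fst p) + deg (snd p) = leaves t"
proof (induction t arbitrary: p)
  case (Node ts)
  show ?case
  proof (cases "ts = []")
    case True
    then have "p \<in> Poly_Mapping.keys (basis (Some tree_x, None) + basis (None, Some tree_x) :: 'k alg2)"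
      using Node.prems by simp
    then have "p \<in> {(Some tree_x, None), (None, Some tree_x)}"
      using Poly_Mapping.keys_add[of "basis (Some tree_x, None) :: 'k alg2" "basis (None, Some tree_x)"]
      by (auto simp: basis_def)
    then show ?thesis using True by auto
  next
    case False
    then have "p \<in> Poly_Mapping.keys (mprod2 (map coadd_tree ts) :: 'k alg2)"
      using Node.prems by simp
    then obtain ps where ps: "ps \<in> listset (map Poly_Mapping.keys (map (coadd_tree :: _ \<Rightarrow> 'k alg2) ts))"
      "p \<in> Poly_Mapping.keys (basis (graft (map fst ps), graft (map snd ps)) :: 'k alg2)"
      unfolding mprod2_def by (rule keys_multilinear_ext)
    have "deg (fst p) + deg (snd p) = sum_list (map (\<lambda>p. deg (fst p) + deg (snd p)) ps)"
      using ps(2) by (simp add: basis_def deg_graft sum_list_addf comp_def)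
    also have "\<dots> = sum_list (map leaves ts)"
      by (rule sum_list_listset[where g = "\<lambda>t. Poly_Mapping.keys (coadd_tree t :: 'k alg2)"])
        (use ps(1) Node.IH in \<open>auto simp: comp_def\<close>)
    finally show ?thesis using False by simp
  qed
qed

lemma deg_coaddition:
  assumes "Poly_Mapping.lookup (coaddition (basis T) :: 'k::field alg2) (V, W) \<noteq> 0"
  shows "deg V + deg W = deg T"
proof (cases T)
  case None
  then show ?thesis
    using assms[unfolded coaddition_basis] by (auto simp: basis_def lookup_single when_def split: if_splits)
next
  case (Some t)
  then show ?thesis
    using assms keys_coadd_tree[where 'k = 'k, of "(V, W)" "Rep_prt t"]
    by (auto simp: coaddition_basis in_keys_iff)
qed

lemma leaves_pos: "leaves t > 0"
proof (induction t)
  case (Node ts)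
  then show ?case by (cases ts) auto
qed

lemma length_le_sum_leaves: "length ts \<le> sum_list (map leaves ts)"
proof (induction ts)
  case (Cons t ts)
  then show ?case using leaves_pos[of t] by simp
qed simp

lemma finite_reduced_leaves: "finite {t. reduced t \<and> leaves t = n}"
proof (induction n rule: less_induct)
  case (less n)
  let ?A = "\<Union>k<n. {t. reduced t \<and> leaves t = k}"
  have fin: "finite ?A" using less by simp
  have "{t. reduced t \<and> leaves t = n} \<subseteq> insert (Node []) (Node ` {ts. set ts \<subseteq> ?A \<and> length ts \<le> n})"
  proof
    fix t assume t: "t \<in> {t. reduced t \<and> leaves t = n}"
    obtain ts where ts: "t = Node ts" by (cases t)
    show "t \<in> insert (Node []) (Node ` {ts. set ts \<subseteq> ?A \<and> length ts \<le> n})"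
    proof (cases "ts = []")
      case False
      with t ts have n: "n = sum_list (map leaves ts)" and len: "length ts \<noteq> 1" by auto
      have "leaves s < n" if s: "s \<in> set ts" for s
      proof -
        obtain as bs where ab: "ts = as @ s # bs" using s by (meson split_list)
        have "length as + length bs > 0" using len ab by auto
        then have "sum_list (map leaves as) + sum_list (map leaves bs) > 0"
          using length_le_sum_leaves[of as] length_le_sum_leaves[of bs] by linarith
        then show ?thesis using n ab by simp
      qed
      then show ?thesis using t ts n length_le_sum_leaves[of ts] by auto
    qed (simp add: ts)
  qed
  moreover have "finite {ts. set ts \<subseteq> ?A \<and> length ts \<le> n}"
    by (rule finite_lists_length_le[OF fin])
  ultimately show ?case by (meson finite.insertI finite_imageI finite_subset)
qed

lemma finite_deg: "finite {T. deg T = n}"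
proof -
  have "T \<in> insert None (Some ` Abs_prt ` {t. reduced t \<and> leaves t = n})" if "deg T = n" for T
  proof (cases T)
    case (Some t)
    then have "t \<in> Abs_prt ` {t. reduced t \<and> leaves t = n}"
      using that by (intro image_eqI[of _ _ "Rep_prt t"]) (simp_all add: Rep_prt_inverse)
    with Some show ?thesis by blast
  qed simp
  then have "{T. deg T = n} \<subseteq> insert None (Some ` Abs_prt ` {t. reduced t \<and> leaves t = n})"
    by blast
  then show ?thesis
    by (rule finite_subset) (simp add: finite_reduced_leaves)
qed

lemma finite_coaddition_hat_support:
  fixes f :: "'k::field alg_hat"
  shows "finite {T. f T * Poly_Mapping.lookup (coaddition (basis T)) p \<noteq> 0}"
proof (rule finite_subset[OF _ finite_deg[of "deg (fst p) + deg (snd p)"]])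
  show "{T. f T * Poly_Mapping.lookup (coaddition (basis T)) p \<noteq> 0}
      \<subseteq> {T. deg T = deg (fst p) + deg (snd p)}"
    using deg_coaddition[where 'k = 'k, of _ "fst p" "snd p"] by auto
qed

end

(*
  For a series f with constant term 1 and a scalar c put
  f^[c] = sum over m of (c gchoose m) (f - 1)^m, with (f - 1)^m the m-ary product; for a natural
  number N this is the N-ary product of N copies of f. The recursion for the coefficients of EXP
  says that multiplying its degree d component by q^d, for every d, yields EXP^[q]. In the
  completed tensor square, both the image of EXP under the co-addition and the tensor square of
  EXP satisfy the same equation: for the first this is compatibility with the products; for the
  second, tensor (f^[c]) (g^[c]) = (tensor f g)^[c] holds at natural numbers c, and every
  coefficient is polynomial in c. In degree d >= 2 the equation for H expresses (q^d - q) H_d by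
  lower degrees, so a solution is determined by its components of degree 0 and 1.
*)

theory Submission
  imports Defs
begin

section \<open>Multilinear extensions with equal arguments\<close>

lemma lookup_basis: "Poly_Mapping.lookup (basis b) c = (if b = c then 1 else 0)"
  by (simp add: basis_def lookup_single when_def)

text \<open>Pascal's rule; the extra summand with \<open>N choose Suc N\<close> vanishes.\<close>

lemma sum_binomial_Suc:
  fixes r :: "nat \<Rightarrow> ('b \<Rightarrow>\<^sub>0 'k::field)"
  shows "(\<Sum>m\<le>Suc N. scale (of_nat (Suc N choose m)) (r m)) =
    (\<Sum>m\<le>N. scale (of_nat (N choose m)) (r m)) + (\<Sum>m\<le>N. scale (of_nat (N choose m)) (r (Suc m)))"
proof -
  have "(\<Sum>m\<le>N. scale (of_nat (N choose Suc m)) (r (Suc m)) :: 'b \<Rightarrow>\<^sub>0 'k) + r 0 =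
      (\<Sum>m\<le>Suc N. scale (of_nat (N choose m)) (r m))"
    by (subst sum.atMost_Suc_shift) (simp add: add.commute)
  also have "\<dots> = (\<Sum>m\<le>N. scale (of_nat (N choose m)) (r m))"
    by (simp add: binomial_eq_0)
  finally show ?thesis
    by (subst sum.atMost_Suc_shift)
      (simp add: fv.scale_left_distrib sum.distrib algebra_simps)
qed

lemma lin_ext_sum_scale:
  "lin_ext (\<lambda>b. \<Sum>m\<in>M. scale (c m) (\<phi> m b)) f = (\<Sum>m\<in>M. scale (c m) (lin_ext (\<phi> m) f))"
  unfolding lin_ext_def fv.scale_sum_right
  by (subst sum.swap) (simp add: mult.commute)

text \<open>Expanding each slot into \<open>e\<close> or \<open>f\<close> gives a binomial theorem
  without any commutativity: \<open>h\<close> deletes \<open>e\<close>, so only the number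
  \<open>m\<close> of slots filled by \<open>f\<close> matters, not their positions. The induction
  splits the first slot.\<close>

lemma multilinear_ext_binomial:
  fixes h :: "'b list \<Rightarrow> ('c \<Rightarrow>\<^sub>0 'k::field)"
  assumes "\<And>us vs. h (us @ e # vs) = h (us @ vs)"
  shows "multilinear_ext h (replicate N (basis e + f)) =
    (\<Sum>m\<le>N. scale (of_nat (N choose m)) (multilinear_ext h (replicate m f)))"
  using assms
proof (induction N arbitrary: h)
  case (Suc N)
  have e: "(\<lambda>bs. h (e # bs)) = h"
    using Suc.prems[of "[]"] by auto
  have IH: "multilinear_ext (\<lambda>bs. h (b # bs)) (replicate N (basis e + f)) =
      (\<Sum>m\<le>N. scale (of_nat (N choose m)) (multilinear_ext (\<lambda>bs. h (b # bs)) (replicate m f)))" for b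
    by (rule Suc.IH) (use Suc.prems[of "b # _"] in simp)
  have "multilinear_ext h (replicate (Suc N) (basis e + f)) =
      multilinear_ext h (replicate N (basis e + f)) +
      lin_ext (\<lambda>b. multilinear_ext (\<lambda>bs. h (b # bs)) (replicate N (basis e + f))) f"
    by (simp add: multilinear_ext_Cons lx.add e)
  also have "\<dots> = (\<Sum>m\<le>N. scale (of_nat (N choose m)) (multilinear_ext h (replicate m f))) +
      (\<Sum>m\<le>N. scale (of_nat (N choose m)) (multilinear_ext h (replicate (Suc m) f)))"
    by (simp add: IH Suc.IH[OF Suc.prems] lin_ext_sum_scale multilinear_ext_Cons)
  finally show ?case by (simp only: sum_binomial_Suc)
qed simp

text \<open>The freedom in \<open>S\<close> lets two elements with different supports be expanded
  over the same lists.\<close>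

lemma multilinear_ext_replicate:
  assumes "finite S" "Poly_Mapping.keys f \<subseteq> S"
  shows "multilinear_ext h (replicate m f) =
    (\<Sum>bs | set bs \<subseteq> S \<and> length bs = m. scale (prod_list (map (Poly_Mapping.lookup f) bs)) (h bs))"
proof (induction m arbitrary: h)
  case 0
  have "{bs. set bs \<subseteq> S \<and> length bs = 0} = {[]}" by auto
  then show ?case by simp
next
  case (Suc m)
  let ?L = "\<lambda>m. {bs. set bs \<subseteq> S \<and> length bs = m}"
  have eq: "?L (Suc m) = (\<lambda>(b, bs). b # bs) ` (S \<times> ?L m)"
    by (auto simp: length_Suc_conv image_iff)
  show ?case
    unfolding eq
    by (simp add: multilinear_ext_Cons Suc.IH lin_ext_superset[OF assms] fv.scale_sum_right
        sum.reindex inj_on_def sum.cartesian_product case_prod_unfold)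
qed

section \<open>Polynomial dependence on the scalar\<close>

lemma gchoose_eq_poly:
  obtains P :: "'k::field_char_0 poly" where "\<And>c. poly P c = c gchoose m"
proof
  fix c :: 'k
  show "poly (smult (1 / fact m) (\<Prod>i=0..<m. [:- of_nat i, 1:])) c = c gchoose m"
    by (simp add: gbinomial_prod_rev poly_prod)
qed

lemma sum_gchoose_eq_poly:
  fixes A :: "nat \<Rightarrow> 'k::field_char_0"
  shows "\<exists>P. \<forall>c. poly P c = (\<Sum>m\<le>n. (c gchoose m) * A m)"
proof -
  have "\<forall>m. \<exists>P :: 'k poly. \<forall>c. poly P c = c gchoose m"
    by (metis gchoose_eq_poly)
  then obtain P :: "nat \<Rightarrow> 'k poly" where P: "\<And>m c. poly (P m) c = c gchoose m"
    by metis
  show ?thesis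
    by (rule exI[of _ "\<Sum>m\<le>n. smult (A m) (P m)"]) (simp add: poly_sum P mult.commute)
qed

text \<open>In characteristic 0 the natural numbers would be infinitely many roots of
  \<open>P - Q\<close>.\<close>

lemma poly_eqI_nat:
  fixes P Q :: "'k::field_char_0 poly"
  assumes "\<And>N::nat. poly P (of_nat N) = poly Q (of_nat N)"
  shows "P = Q"
proof (rule ccontr)
  assume "P \<noteq> Q"
  then have "finite {c. poly (P - Q) c = 0}"
    by (intro poly_roots_finite) simp
  moreover have "range of_nat \<subseteq> {c. poly (P - Q) c = 0}"
    using assms by auto
  ultimately have "finite (range (of_nat :: nat \<Rightarrow> 'k))"
    by (rule finite_subset[rotated])
  then show False
    by (simp add: finite_image_iff inj_of_nat)
qed

section \<open>Scalar powers and their fixed-point equation\<close>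

text \<open>Covers the basis of the algebra and the basis of its tensor square at once.\<close>

locale grafting =
  fixes gr :: "'b list \<Rightarrow> 'b" and dg :: "'b \<Rightarrow> nat" and e :: 'b
  assumes gr_e: "gr (us @ e # vs) = gr (us @ vs)"
    and gr_single: "gr [b] = b"
    and dg_gr: "dg (gr bs) = sum_list (map dg bs)"
    and dg_eq_0: "dg b = 0 \<longleftrightarrow> b = e"
begin

lemma gr_Nil: "gr [] = e"
  using dg_gr[of "[]"] by (simp add: dg_eq_0)

abbreviation mp :: "('b \<Rightarrow>\<^sub>0 'k::field) list \<Rightarrow> ('b \<Rightarrow>\<^sub>0 'k)" where
  "mp \<equiv> multilinear_ext (\<lambda>bs. basis (gr bs))"

text \<open>The coefficient of \<open>f^[c]\<close> at \<open>b\<close>. If \<open>f\<close> has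
  constant term 1, stopping at \<open>dg b\<close> loses nothing, because \<open>m\<close> factors
  without constant term have a product of degree at least \<open>m\<close>.\<close>

definition gpow :: "'k::field_char_0 \<Rightarrow> ('b \<Rightarrow>\<^sub>0 'k) \<Rightarrow> 'b \<Rightarrow> 'k" where
  "gpow c f b = (\<Sum>m\<le>dg b. (c gchoose m) * Poly_Mapping.lookup (mp (replicate m (f - basis e))) b)"

lemma gpow_poly: "\<exists>P. \<forall>c. poly P c = gpow c f b"
  unfolding gpow_def by (rule sum_gchoose_eq_poly)

lemma mp_single: "mp [f] = f"
  by (simp add: multilinear_ext_Cons gr_single lin_ext_expand)

lemma lookup_mp_replicate:
  assumes "finite S" "Poly_Mapping.keys f \<subseteq> S"
  shows "Poly_Mapping.lookup (mp (replicate m f)) b =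
    (\<Sum>bs | set bs \<subseteq> S \<and> length bs = m. prod_list (map (Poly_Mapping.lookup f) bs) * (if gr bs = b then 1 else 0))"
  by (auto simp: multilinear_ext_replicate[OF assms] lookup_sum lookup_basis
      intro!: sum.cong)

lemma prod_list_map_zero:
  fixes \<phi> :: "'b \<Rightarrow> 'k::field"
  assumes "\<phi> e = 0" "e \<in> set bs"
  shows "prod_list (map \<phi> bs) = 0"
  using assms by (force simp: prod_list_zero_iff)

lemma length_le_dg:
  assumes "e \<notin> set bs"
  shows "length bs \<le> sum_list (map dg bs)"
  using assms
proof (induction bs)
  case (Cons b bs)
  then have "dg b \<noteq> 0" using dg_eq_0 by auto
  with Cons show ?case by auto
qed simp

text \<open>A list of \<open>m\<close> basis elements other than \<open>e\<close> has total degree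
  at least \<open>m\<close>, and any list containing \<open>e\<close> contributes a zero
  factor.\<close>

lemma lookup_mp_eq_0:
  assumes "Poly_Mapping.lookup f e = 0" "dg b < m"
  shows "Poly_Mapping.lookup (mp (replicate m f)) b = 0"
  unfolding lookup_mp_replicate[OF finite_keys order_refl]
proof (rule sum.neutral, safe)
  fix bs :: "'b list" assume "m = length bs"
  then have "e \<in> set bs" if "gr bs = b"
    using assms(2) length_le_dg[of bs] dg_gr[of bs] that by (metis leD)
  then show "prod_list (map (Poly_Mapping.lookup f) bs) * (if gr bs = b then 1 else 0) = 0"
    using prod_list_map_zero[of "Poly_Mapping.lookup f", OF assms(1)] by simp
qed

text \<open>At least one further entry is present, and it has positive degree.\<close>

lemma dg_less:
  assumes "e \<notin> set bs" "length bs \<ge> 2" "c \<in> set bs"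
  shows "dg c < dg (gr bs)"
proof -
  obtain us vs where bs: "bs = us @ c # vs" using assms(3) by (meson split_list)
  have "length us + length vs \<le> sum_list (map dg us) + sum_list (map dg vs)"
    using assms(1) bs length_le_dg[of us] length_le_dg[of vs] by simp
  moreover have "length us + length vs > 0" using assms(2) bs by (cases us) auto
  ultimately have "sum_list (map dg us) + sum_list (map dg vs) > 0" by linarith
  then show ?thesis using bs by (simp add: dg_gr)
qed

text \<open>By \<open>dg_less\<close>, the factors of a product equal to \<open>b\<close> have
  smaller degree than \<open>b\<close>. This makes the fixed-point equation triangular in the
  degree.\<close>

lemma lookup_mp_cong:
  assumes "Poly_Mapping.lookup f e = 0" "Poly_Mapping.lookup g e = 0" "m \<ge> 2"
    and eq: "\<And>c. dg c < dg b \<Longrightarrow> Poly_Mapping.lookup f c = Poly_Mapping.lookup g c"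
  shows "Poly_Mapping.lookup (mp (replicate m f)) b = Poly_Mapping.lookup (mp (replicate m g)) b"
proof -
  let ?S = "Poly_Mapping.keys f \<union> Poly_Mapping.keys g"
  have "prod_list (map (Poly_Mapping.lookup f) bs) = prod_list (map (Poly_Mapping.lookup g) bs)"
    if "length bs = m" "gr bs = b" for bs
  proof (cases "e \<in> set bs")
    case True
    then show ?thesis using assms(1,2) by (simp add: prod_list_map_zero)
  next
    case False
    then have "map (Poly_Mapping.lookup f) bs = map (Poly_Mapping.lookup g) bs"
      using that assms(3) dg_less by (auto intro!: eq)
    then show ?thesis by (rule arg_cong)
  qed
  then show ?thesis
    by (subst (1 2) lookup_mp_replicate[where S = ?S]) (auto intro!: sum.cong)
qed

lemma gpow_of_nat:
  fixes f :: "'b \<Rightarrow>\<^sub>0 'k::field_char_0"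
  assumes "Poly_Mapping.lookup f e = 1"
  shows "gpow (of_nat N) f b = Poly_Mapping.lookup (mp (replicate N f)) b"
proof -
  let ?f = "f - basis e"
  let ?t = "\<lambda>m. of_nat (N choose m) * Poly_Mapping.lookup (mp (replicate m ?f)) b"
  have f: "Poly_Mapping.lookup ?f e = 0"
    using assms by (simp add: lookup_minus lookup_basis)
  have "mp (replicate N (basis e + ?f)) = (\<Sum>m\<le>N. scale (of_nat (N choose m)) (mp (replicate m ?f)))"
    by (rule multilinear_ext_binomial) (simp add: gr_e)
  then have "Poly_Mapping.lookup (mp (replicate N f)) b = (\<Sum>m\<le>N. ?t m)"
    by (simp add: lookup_sum)
  \<comment> \<open>The two ranges are compared inside a common one: beyond \<open>N\<close> the
    binomial coefficient vanishes, beyond \<open>dg b\<close> the power does.\<close>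
  also have "\<dots> = (\<Sum>m\<le>max N (dg b). ?t m)"
    by (rule sum.mono_neutral_left) auto
  also have "\<dots> = (\<Sum>m\<le>dg b. ?t m)"
    by (rule sum.mono_neutral_right) (auto simp: lookup_mp_eq_0[OF f])
  finally show ?thesis
    by (simp add: gpow_def binomial_gbinomial)
qed

text \<open>The power with \<open>m = 0\<close> does not reach \<open>b\<close>, and
  \<open>m = 1\<close> gives the linear term. If \<open>f\<close> has constant term 1, the remaining
  sum involves only coefficients of degree below \<open>dg b\<close>.\<close>

lemma gpow_step:
  assumes "dg b \<ge> 2"
  shows "gpow c f b = c * Poly_Mapping.lookup f b +
    (\<Sum>m=2..dg b. (c gchoose m) * Poly_Mapping.lookup (mp (replicate m (f - basis e))) b)"
proof -
  have b: "b \<noteq> e" using assms dg_eq_0[of b] by auto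
  have "{..dg b} = insert 0 (insert 1 {2..dg b})" using assms by auto
  then show ?thesis
    unfolding gpow_def using b
    by (simp add: mp_single gr_Nil lookup_basis lookup_minus)
qed

text \<open>Induction on the degree: the nonlinear parts agree by \<open>lookup_mp_cong\<close>, and
  the factor \<open>c ^ d - c\<close> left on the coefficient of degree \<open>d\<close> is nonzero.
  The equations are required only up to degree \<open>n\<close>, so that truncated series
  qualify.\<close>

lemma gpow_fixpoint_unique:
  fixes f g :: "'b \<Rightarrow>\<^sub>0 'k::field_char_0"
  assumes f: "\<And>b. dg b \<le> n \<Longrightarrow> gpow c f b = c ^ dg b * Poly_Mapping.lookup f b"
    and g: "\<And>b. dg b \<le> n \<Longrightarrow> gpow c g b = c ^ dg b * Poly_Mapping.lookup g b"
    and fe: "Poly_Mapping.lookup f e = 1" and ge: "Poly_Mapping.lookup g e = 1"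
    and one: "\<And>b. dg b = 1 \<Longrightarrow> Poly_Mapping.lookup f b = Poly_Mapping.lookup g b"
    and c: "\<And>d. d \<ge> 2 \<Longrightarrow> c ^ d \<noteq> c"
    and b: "dg b \<le> n"
  shows "Poly_Mapping.lookup f b = Poly_Mapping.lookup g b"
  using b
proof (induction "dg b" arbitrary: b rule: less_induct)
  case less
  consider "dg b = 0" | "dg b = 1" | "dg b \<ge> 2" by linarith
  then show ?case
  proof cases
    case 1
    then show ?thesis using dg_eq_0 fe ge by simp
  next
    case 2
    then show ?thesis by (rule one)
  next
    case 3
    have "Poly_Mapping.lookup (mp (replicate m (f - basis e))) b =
        Poly_Mapping.lookup (mp (replicate m (g - basis e))) b" if "m \<ge> 2" for m
      by (rule lookup_mp_cong)
        (use that fe ge less in \<open>simp_all add: lookup_minus lookup_basis\<close>)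
    then have "gpow c f b - c * Poly_Mapping.lookup f b = gpow c g b - c * Poly_Mapping.lookup g b"
      by (simp add: gpow_step[OF 3])
    then have "(c ^ dg b - c) * (Poly_Mapping.lookup f b - Poly_Mapping.lookup g b) = 0"
      using less.prems by (simp add: f g algebra_simps)
    then show ?thesis using c[OF 3] by simp
  qed
qed

end

section \<open>Scalar powers under tensor products and co-addition\<close>

lemma deg_eq_0_iff: "deg T = 0 \<longleftrightarrow> T = None"
  by (cases T) (use leaves_pos in \<open>auto simp: neq0_conv[symmetric] simp del: neq0_conv\<close>)

interpretation A: grafting graft deg None
  by unfold_locales (simp_all add: graft_Cons_None deg_graft deg_eq_0_iff)

abbreviation deg2 :: "prt1 \<times> prt1 \<Rightarrow> nat" where
  "deg2 p \<equiv> deg (fst p) + deg (snd p)"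

interpretation B: grafting "\<lambda>ps. (graft (map fst ps), graft (map snd ps))" deg2 "(None, None)"
  by unfold_locales
    (auto simp: graft_Cons_None deg_graft deg_eq_0_iff sum_list_addf comp_def prod_eq_iff)

text \<open>At a natural number \<open>c\<close> this is \<open>mprod2_tensor\<close> for
  \<open>c\<close> equal factors. Both sides are polynomial in \<open>c\<close>, so the identity
  extends to all scalars.\<close>

lemma gpow_tensor:
  fixes f g :: "'k::field_char_0 alg"
  assumes "Poly_Mapping.lookup f None = 1" "Poly_Mapping.lookup g None = 1"
  shows "B.gpow c (tensor f g) (V, W) = A.gpow c f V * A.gpow c g W"
proof -
  obtain P where P: "\<And>c. poly P c = B.gpow c (tensor f g) (V, W)"
    using B.gpow_poly by blast
  obtain Q where Q: "\<And>c. poly Q c = A.gpow c f V"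
    using A.gpow_poly by blast
  obtain R where R: "\<And>c. poly R c = A.gpow c g W"
    using A.gpow_poly by blast
  have "P = Q * R"
  proof (rule poly_eqI_nat)
    fix N :: nat
    have "mprod2 (map2 tensor (replicate N f) (replicate N g)) =
        tensor (mprod (replicate N f)) (mprod (replicate N g))"
      by (rule mprod2_tensor) simp
    then have "mprod2 (replicate N (tensor f g)) = tensor (mprod (replicate N f)) (mprod (replicate N g))"
      by (simp add: zip_replicate)
    then show "poly P (of_nat N) = poly (Q * R) (of_nat N)"
      using assms
      by (simp add: P Q R A.gpow_of_nat B.gpow_of_nat lookup_tensor mprod2_def[symmetric] mprod_def[symmetric])
  qed
  then show ?thesis by (metis P Q R poly_mult)
qed

text \<open>Co-addition preserves degree, so a finite index set independent of \<open>f\<close>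
  suffices.\<close>

lemma lookup_lin_ext_coadd:
  fixes f :: "'k::field alg"
  shows "Poly_Mapping.lookup (lin_ext coadd_basis f) p =
    (\<Sum>T | deg T = deg2 p. Poly_Mapping.lookup f T * Poly_Mapping.lookup (coadd_basis T) p)"
proof -
  let ?t = "\<lambda>T. Poly_Mapping.lookup f T * Poly_Mapping.lookup (coadd_basis T) p"
  let ?D = "{T. deg T = deg2 p}"
  have fin: "finite (Poly_Mapping.keys f \<union> ?D)"
    using finite_deg by simp
  have "Poly_Mapping.lookup (lin_ext coadd_basis f) p = (\<Sum>T\<in>Poly_Mapping.keys f \<union> ?D. ?t T)"
    by (simp add: lin_ext_superset[OF fin] lookup_sum)
  also have "\<dots> = (\<Sum>T\<in>?D. ?t T)"
  proof (rule sum.mono_neutral_right[OF fin])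
    show "\<forall>T\<in>Poly_Mapping.keys f \<union> ?D - ?D. ?t T = 0"
      using deg_coaddition[where 'k = 'k, of _ "fst p" "snd p"] by (auto simp: coaddition_basis)
  qed simp
  finally show ?thesis .
qed

text \<open>Lists of every length are covered, since \<open>gpow\<close> also involves the powers
  with \<open>m = 0\<close> and \<open>m = 1\<close>.\<close>

lemma lin_ext_coadd_mprod: "lin_ext coadd_basis (mprod fs) = mprod2 (map (lin_ext coadd_basis) fs)"
  unfolding mprod_def lin_ext_multilinear_ext
  by (simp add: coadd_basis_graft mprod2_def multilinear_ext_map_lin_ext)

text \<open>Co-addition preserves the unit and all products, hence commutes with every power of
  \<open>f - 1\<close>. The cutoffs on both sides coincide because only trees of degree
  \<open>deg2 p\<close> occur.\<close>

lemma gpow_coadd: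
  fixes f :: "'k::field_char_0 alg"
  shows "B.gpow c (lin_ext coadd_basis f) p =
    (\<Sum>T | deg T = deg2 p. A.gpow c f T * Poly_Mapping.lookup (coadd_basis T) p)"
proof -
  let ?f = "f - basis None"
  have e: "lin_ext coadd_basis f - basis (None, None) = lin_ext coadd_basis ?f"
    by (simp add: lx.diff)
  have "mprod2 (replicate m (lin_ext coadd_basis ?f)) = lin_ext coadd_basis (mprod (replicate m ?f))" for m
    by (simp add: lin_ext_coadd_mprod)
  then have "B.gpow c (lin_ext coadd_basis f) p = (\<Sum>m\<le>deg2 p. (c gchoose m) *
      (\<Sum>T | deg T = deg2 p. Poly_Mapping.lookup (mprod (replicate m ?f)) T * Poly_Mapping.lookup (coadd_basis T) p))"
    unfolding B.gpow_def e mprod2_def[symmetric] by (simp add: lookup_lin_ext_coadd)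
  also have "\<dots> = (\<Sum>T | deg T = deg2 p. (\<Sum>m\<le>deg2 p. (c gchoose m) *
      Poly_Mapping.lookup (mprod (replicate m ?f)) T) * Poly_Mapping.lookup (coadd_basis T) p)"
    unfolding sum_distrib_left sum_distrib_right by (subst sum.swap) (simp add: mult.assoc)
  also have "\<dots> = (\<Sum>T | deg T = deg2 p. A.gpow c f T * Poly_Mapping.lookup (coadd_basis T) p)"
    by (rule sum.cong) (auto simp: A.gpow_def mprod_def)
  finally show ?thesis .
qed

section \<open>The fixed-point equation for the exponential\<close>

text \<open>A tree determines its children, so at most one list of \<open>m\<close> nonempty trees
  grafts to \<open>t\<close>; lists with an empty tree contribute 0.\<close>

lemma lookup_mprod_replicate:
  fixes f :: "'k::field alg"
  assumes f: "Poly_Mapping.lookup f None = 0" and m: "m \<ge> 2"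
    and t: "Rep_prt t = Node (map Rep_prt us)"
  shows "Poly_Mapping.lookup (mprod (replicate m f)) (Some t) =
    (if length us = m then prod_list (map (\<lambda>u. Poly_Mapping.lookup f (Some u)) us) else 0)"
proof -
  \<comment> \<open>\<open>map Some us\<close> has to be among the lists even if \<open>f\<close>
    vanishes at some child.\<close>
  let ?S = "Poly_Mapping.keys f \<union> Some ` set us"
  let ?t = "\<lambda>bs. prod_list (map (Poly_Mapping.lookup f) bs) * (if graft bs = Some t then 1 else 0)"
  let ?L = "{bs. set bs \<subseteq> ?S \<and> length bs = m}"
  have fin: "finite ?L" by (rule finite_lists_length_eq) simp
  have nz: "bs = map Some us" if "?t bs \<noteq> 0" "length bs = m" for bs
  proof -
    have "None \<notin> set bs" using that(1) A.prod_list_map_zero[of "Poly_Mapping.lookup f", OF f] by auto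
    then have bs: "bs = map Some (map the bs)"
      by (auto intro!: map_idI[symmetric]) (metis option.collapse)
    define vs where "vs = map the bs"
    have len: "length vs \<ge> 2" using m that(2) by (simp add: vs_def)
    define s where "s = Abs_prt (Node (map Rep_prt vs))"
    have s: "Rep_prt s = Node (map Rep_prt vs)"
      unfolding s_def by (rule Rep_Abs_prt_Node) (use len in simp)
    have "graft bs = Some s" using graft_Some[OF s len] bs by (simp add: vs_def)
    moreover have "graft bs = Some t" using that(1) by (auto split: if_splits)
    ultimately have "map Rep_prt vs = map Rep_prt us" using s t by simp
    then have "vs = us" using inj_map_eq_map[of Rep_prt] by (simp add: inj_def Rep_prt_inject)
    then show ?thesis using bs by (simp add: vs_def)
  qed
  have "Poly_Mapping.lookup (mprod (replicate m f)) (Some t) = (\<Sum>bs\<in>?L. ?t bs)"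
    unfolding mprod_def by (rule A.lookup_mp_replicate) auto
  also have "\<dots> = (\<Sum>bs\<in>?L \<inter> {map Some us}. ?t bs)"
    by (rule sum.mono_neutral_right[OF fin]) (use nz in auto)
  also have "\<dots> = (if length us = m then ?t (map Some us) else 0)"
  proof (cases "length us = m")
    case True
    then have "?L \<inter> {map Some us} = {map Some us}" by auto
    with True show ?thesis by simp
  next
    case False
    then have "?L \<inter> {map Some us} = {}" by auto
    with False show ?thesis by simp
  qed
  also have "\<dots> = (if length us = m then prod_list (map (\<lambda>u. Poly_Mapping.lookup f (Some u)) us) else 0)"
    using graft_Some[OF t] m by (auto simp: comp_def)
  finally show ?thesis .
qed

text \<open>The two sides are polynomials of degrees \<open>d\<close> and 1.\<close>

lemma qvar_power_neq: "qvar ^ d \<noteq> qvar" if "d \<ge> 2"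
proof -
  have "qvar ^ d = Fract ([:0, 1:] ^ d) 1" for d
    unfolding qvar_def by (induction d) (simp_all add: One_fract_def)
  moreover have "degree ([:0, 1:] ^ d :: rat poly) = d"
    by (simp add: degree_power_eq)
  ultimately show ?thesis
    using that by (auto simp: qvar_def eq_fract)
qed

text \<open>
  Coefficients of degree at most \<open>n\<close> are computed in a truncation, which lies in the
  uncompleted algebra, where the product and co-addition are defined.
\<close>

lift_definition EXP_trunc :: "nat \<Rightarrow> ratfun alg" is "\<lambda>n T. EXP T when deg T \<le> n"
proof -
  fix n
  have "{T. deg T \<le> n} = (\<Union>k\<le>n. {T. deg T = k})" by auto
  then have "finite {T. deg T \<le> n}" by (simp add: finite_deg)
  then show "finite {T. (EXP T when deg T \<le> n) \<noteq> 0}"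
    by (rule finite_subset[rotated]) auto
qed

lemma lookup_EXP_trunc: "deg T \<le> n \<Longrightarrow> Poly_Mapping.lookup (EXP_trunc n) T = EXP T"
  by transfer simp

text \<open>Clears the denominator of the recursion, which is nonzero since \<open>t\<close> has at
  least two leaves.\<close>

lemma EXP_step:
  assumes t: "Rep_prt t = Node (map Rep_prt us)" and us: "length us \<ge> 2"
  shows "(qvar ^ deg (Some t) - qvar) * EXP (Some t) =
    (qvar gchoose length us) * prod_list (map (\<lambda>u. EXP (Some u)) us)"
proof -
  have "deg (Some t) \<ge> 2"
    using us length_le_sum_leaves[of "map Rep_prt us"] t by auto
  then have "qvar ^ deg (Some t) - qvar \<noteq> 0" using qvar_power_neq by simp
  then show ?thesis using us t by (auto simp: comp_def)
qed

text \<open>For a root of arity at least 2, only the power with \<open>m\<close> equal to this arity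
  survives in the sum of \<open>gpow_step\<close>. By \<open>EXP_step\<close> it equals
  \<open>(q^d - q) EXP T\<close>, which the linear term \<open>q EXP T\<close> completes to
  \<open>q^d EXP T\<close>.\<close>

lemma gpow_EXP_trunc:
  assumes "deg T \<le> n"
  shows "A.gpow qvar (EXP_trunc n) T = qvar ^ deg T * EXP T"
proof (cases T)
  case None
  then show ?thesis by (simp add: A.gpow_def lookup_basis)
next
  case (Some t)
  obtain ts where ts: "Rep_prt t = Node ts" by (cases "Rep_prt t")
  obtain us where us: "ts = map Rep_prt us" "length us \<noteq> 1"
    using prt_Node_obtain[OF ts] by blast
  have t: "Rep_prt t = Node (map Rep_prt us)" using ts us by simp
  show ?thesis
  proof (cases "us = []")
    case True
    then show ?thesis
      using t Some assms lookup_EXP_trunc[OF assms]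
      by (simp add: A.gpow_def A.mp_single lookup_basis lookup_minus)
  next
    case False
    then have len: "length us \<ge> 2" using us by (cases us; cases "tl us") auto
    have le: "length us \<le> deg T"
      using length_le_sum_leaves[of "map Rep_prt us"] t Some by auto
    let ?f = "EXP_trunc n - basis None"
    have f: "Poly_Mapping.lookup ?f None = 0"
      by (simp add: lookup_minus lookup_basis lookup_EXP_trunc)
    have sub: "Poly_Mapping.lookup ?f (Some u) = EXP (Some u)" if "u \<in> set us" for u
    proof -
      have "leaves (Rep_prt u) \<le> sum_list (map (\<lambda>u. leaves (Rep_prt u)) us)"
        by (rule member_le_sum_list) (use that in auto)
      also have "\<dots> = deg T" using t Some False by (simp add: comp_def)
      finally have "deg (Some u) \<le> n" using assms by simp
      then show ?thesis
        by (simp add: lookup_minus lookup_basis lookup_EXP_trunc del: deg.simps EXP.simps)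
    qed
    have "(\<Sum>m=2..deg T. (qvar gchoose m) * Poly_Mapping.lookup (A.mp (replicate m ?f)) T) =
        (\<Sum>m=2..deg T. if m = length us then (qvar gchoose m) * prod_list (map (\<lambda>u. EXP (Some u)) us) else 0)"
      unfolding mprod_def[symmetric] Some
      by (intro sum.cong refl)
        (auto simp: lookup_mprod_replicate[OF f _ t] sub cong: map_cong simp del: EXP.simps)
    also have "\<dots> = (qvar gchoose length us) * prod_list (map (\<lambda>u. EXP (Some u)) us)"
      using len le by (simp del: EXP.simps)
    finally show ?thesis
      using len le EXP_step[OF t len] lookup_EXP_trunc[OF assms] Some
      by (simp add: A.gpow_step algebra_simps del: EXP.simps deg.simps)
  qed
qed

section \<open>Comparison in the completed tensor square\<close>

lemma coaddition_hat_eq: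
  fixes f :: "'k::field alg_hat"
  shows "coaddition_hat f p = (\<Sum>T | deg T = deg2 p. f T * Poly_Mapping.lookup (coadd_basis T) p)"
  unfolding coaddition_hat_def coaddition_basis
proof (rule Sum_any.expand_superset)
  show "finite {T. deg T = deg2 p}" by (rule finite_deg)
  show "{T. f T * Poly_Mapping.lookup (coadd_basis T) p \<noteq> 0} \<subseteq> {T. deg T = deg2 p}"
    using deg_coaddition[where 'k = 'k, of _ "fst p" "snd p"] by (auto simp: coaddition_basis)
qed

text \<open>In a reduced tree a root with children has at least two, hence at least two leaves lie
  below it.\<close>

lemma deg_eq_1:
  assumes "deg T = 1"
  shows "T = Some tree_x"
proof (cases T)
  case (Some t)
  obtain ts where ts: "Rep_prt t = Node ts" by (cases "Rep_prt t")
  moreover have "length ts \<noteq> 1" using reduced_Rep_prt[of t] ts by simp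
  moreover have "length ts \<le> 1"
    using length_le_sum_leaves[of ts] assms Some ts by (auto split: if_splits)
  ultimately have "Rep_prt t = Node []" by (cases ts) auto
  then show ?thesis
    using Some by (metis Rep_prt_inverse tree_x_def)
qed (use assms in simp)

theorem proposition5p1:
  shows "coaddition_hat EXP = tensor_hat EXP EXP"
proof
  fix p
  \<comment> \<open>The coefficient at \<open>p\<close> depends only on degrees up to that of
    \<open>p\<close>, so one truncation at \<open>n\<close> serves both sides.\<close>
  define n where "n = deg2 p"
  define E where "E = EXP_trunc n"
  have E: "Poly_Mapping.lookup E T = EXP T" if "deg T \<le> n" for T
    using that by (simp add: E_def lookup_EXP_trunc)
  have gpow_E: "A.gpow qvar E T = qvar ^ deg T * EXP T" if "deg T \<le> n" for T
    using that by (simp add: E_def gpow_EXP_trunc)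
  let ?D = "lin_ext coadd_basis E" and ?E2 = "tensor E E"
  have D: "Poly_Mapping.lookup ?D b = coaddition_hat EXP b" if "deg2 b \<le> n" for b
    unfolding lookup_lin_ext_coadd coaddition_hat_eq
    by (rule sum.cong) (use that E in auto)
  have E2: "Poly_Mapping.lookup ?E2 b = tensor_hat EXP EXP b" if "deg2 b \<le> n" for b
    using that E by (cases b) (simp add: lookup_tensor tensor_hat_def)
  have deg0: "{T. deg T = 0} = {None}" by (auto simp: deg_eq_0_iff)
  have deg1: "{T. deg T = 1} = {Some tree_x}" using deg_eq_1 by auto
  have E_None: "Poly_Mapping.lookup E None = 1" using E[of None] by simp
  have "Poly_Mapping.lookup ?D p = Poly_Mapping.lookup ?E2 p"
  proof (rule B.gpow_fixpoint_unique[where n = n and c = qvar])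
    fix b assume b: "deg2 b \<le> n"
    \<comment> \<open>All trees in the sum have degree \<open>deg2 b\<close>, so the power of
      \<open>qvar\<close> is a common factor.\<close>
    have "B.gpow qvar ?D b = (\<Sum>T | deg T = deg2 b. qvar ^ deg2 b * (EXP T * Poly_Mapping.lookup (coadd_basis T) b))"
      unfolding gpow_coadd by (rule sum.cong) (use b gpow_E in auto)
    then show "B.gpow qvar ?D b = qvar ^ deg2 b * Poly_Mapping.lookup ?D b"
      using b by (simp add: D coaddition_hat_eq sum_distrib_left)
    \<comment> \<open>The powers of \<open>qvar\<close> from the two tensor factors multiply to
      exponent \<open>deg V + deg W\<close>.\<close>
    show "B.gpow qvar ?E2 b = qvar ^ deg2 b * Poly_Mapping.lookup ?E2 b"
      using b E gpow_E
      by (cases b) (simp add: gpow_tensor[OF E_None E_None] lookup_tensor power_add)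
  next
    show "Poly_Mapping.lookup ?D (None, None) = 1"
      using E_None by (simp add: lookup_lin_ext_coadd deg0 lookup_basis)
    show "Poly_Mapping.lookup ?E2 (None, None) = 1"
      by (simp add: lookup_tensor E_None)
  next
    fix b assume b: "deg2 b = 1"
    have "b \<in> {(Some tree_x, None), (None, Some tree_x)}"
      using b deg_eq_1 by (cases b) (auto simp: add_is_1 deg_eq_0_iff)
    moreover have "coadd_basis (Some tree_x) =
        (basis (Some tree_x, None) + basis (None, Some tree_x) :: ratfun alg2)"
      by simp
    ultimately show "Poly_Mapping.lookup ?D b = Poly_Mapping.lookup ?E2 b"
      unfolding lookup_lin_ext_coadd b deg1
      by (auto simp: lookup_tensor E_None lookup_add lookup_basis)
  qed (simp_all add: qvar_power_neq n_def)
  then show "coaddition_hat EXP p = tensor_hat EXP EXP p"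
    by (simp add: D E2 n_def)
qed

end
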